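(* Let $n\ge 1$ be an integer, let $p(f)\in[0,1]$ for each edge $f\in E(K_{n,n})$, and let $\{Y(f)\}_{f\in E(K_{n,n})}$ be independent random variables with $\mathbb{P}(Y(f)=1)=p(f)=1-\mathbb{P}(Y(f)=0)$. Let $G$ be the random subgraph of $K_{n,n}$ formed by all edges $f$ with $Y(f)=1$. For $L\ge 0$ let $U_n=U_n(L)$ be the maximum size of an $L$-constrained planar matching in $G$, and let $p_{av}=p_{av}(L)=\frac{1}{\zeta_L}\sum_{f\in\mathcal{T}_L}p(f)$, where $\mathcal{T}_L$ is the set of all edges of $K_{n,n}$ of length at most $L$ and $\zeta_L=|\mathcal{T}_L|$. Then $$\mathrm{var}(U_n)\le 2\,\mathbb{E}U_n ,$$ and, for $L\ge 1$, $$\mathbb{P}\left(\frac{n\,p_{av}}{28L}\le U_n\le \frac{9\,n\,p_{av}L}{2}\right)\ge 1-2\exp\left(-\frac{n\,p_{av}L}{16}\right).$$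
   Context: $K_{n,n}$ is the complete bipartite graph with top vertices $u_1,\dots,u_n$ and bottom vertices $v_1,\dots,v_n$; its edge set $E(K_{n,n})$ consists of all pairs $(u_i,v_j)$, $1\le i,j\le n$ (including $i=j$). The length of the edge $(u_i,v_j)$ is $|i-j|$. A matching of size $t$ is a set of $t$ pairwise vertex-disjoint edges. A matching $\{(u_{i_1},v_{j_1}),\dots,(u_{i_t},v_{j_t})\}$ is a planar matching if its edges can be indexed so that $i_1<i_2<\dots<i_t$ and $j_1<j_2<\dots<j_t$. The empty matching is a planar matching of size $0$. A planar matching is $L$-constrained if each of its edges has length at most $L$. The edge probabilities $p(f)$ need not be equal.
   Formalization: The probability bound is stated for 1 ≤ L ≤ n rather than all L ≥ 1: for n = 1, p = 1/2, L = 1000 the printed bound fails, since P(U_1 = 0) = 1/2. Edge lengths are at most n − 1, so U_n and p_av do not change for L > n. *)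

theory Defs
  imports "HOL-Probability.Probability"
begin

(* The pair (i, j) stands for the edge between the top vertex u_i and the bottom
   vertex v_j, so a subgraph of K_{n,n} is a set of such pairs. *)

definition knn_edges :: "nat \<Rightarrow> (nat \<times> nat) set" where
  "knn_edges n = {1..n} \<times> {1..n}"

definition edge_length :: "nat \<times> nat \<Rightarrow> nat" where
  "edge_length f = nat \<bar>int (fst f) - int (snd f)\<bar>"

definition is_matching :: "(nat \<times> nat) set \<Rightarrow> bool" where
  "is_matching A \<longleftrightarrow> finite A \<and>
     (\<forall>e\<in>A. \<forall>f\<in>A. e \<noteq> f \<longrightarrow> fst e \<noteq> fst f \<and> snd e \<noteq> snd f)"

definition is_planar_matching :: "(nat \<times> nat) set \<Rightarrow> bool" where
  "is_planar_matching A \<longleftrightarrow> is_matching A \<and>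
     (\<exists>i j. strict_mono_on {1..card A} i \<and> strict_mono_on {1..card A} j \<and>
            A = (\<lambda>k. (i k, j k)) ` {1..card A})"

definition length_constrained :: "real \<Rightarrow> (nat \<times> nat) set \<Rightarrow> bool" where
  "length_constrained L A \<longleftrightarrow> (\<forall>f\<in>A. real (edge_length f) \<le> L)"

definition max_planar_matching :: "real \<Rightarrow> (nat \<times> nat) set \<Rightarrow> nat" where
  "max_planar_matching L G =
     Max {card A |A. A \<subseteq> G \<and> is_planar_matching A \<and> length_constrained L A}"

definition short_edges :: "nat \<Rightarrow> real \<Rightarrow> (nat \<times> nat) set" where
  "short_edges n L = {f \<in> knn_edges n. real (edge_length f) \<le> L}"

definition p_av :: "nat \<Rightarrow> (nat \<times> nat \<Rightarrow> real) \<Rightarrow> real \<Rightarrow> real" where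
  "p_av n p L = (\<Sum>f\<in>short_edges n L. p f) / real (card (short_edges n L))"

definition random_subgraph ::
    "nat \<Rightarrow> (nat \<times> nat \<Rightarrow> 'a \<Rightarrow> real) \<Rightarrow> 'a \<Rightarrow> (nat \<times> nat) set" where
  "random_subgraph n Y \<omega> = {f \<in> knn_edges n. Y f \<omega> = 1}"

definition U :: "nat \<Rightarrow> (nat \<times> nat \<Rightarrow> 'a \<Rightarrow> real) \<Rightarrow> real \<Rightarrow> 'a \<Rightarrow> real" where
  "U n Y L \<omega> = real (max_planar_matching L (random_subgraph n Y \<omega>))"

end

theory Submission
  imports Defs
begin

text \<open>
  Adding an edge raises the maximum size by at most one, and an edge of the graph whose deletion
  lowers it lies in every maximum matching, so the Efron--Stein inequality bounds the variance by
  the mean. For the concentration bound, the maximum size is at most the number of edges in the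
  band of short edges and, since the band is a union of at most \<open>3 L\<close> diagonals, each a planar matching, at least that number divided by
  \<open>3 L\<close>; Chernoff bounds for the number of edges in the band then suffice.
\<close>

section \<open>Averaging over a random subset\<close>

text \<open>The expectation of \<open>g S\<close> for a random \<open>S \<subseteq> A\<close> that
  contains each \<open>f\<close> independently with probability \<open>p f\<close>. As a finite sum
  it permits induction on \<open>A\<close> and keeps measure theory out of the combinatorial
  part.\<close>

definition subset_mean :: "('a \<Rightarrow> real) \<Rightarrow> 'a set \<Rightarrow> ('a set \<Rightarrow> real) \<Rightarrow> real" where
  "subset_mean p A g = (\<Sum>S\<in>Pow A. (\<Prod>f\<in>S. p f) * (\<Prod>f\<in>A - S. 1 - p f) * g S)"

lemma subset_mean_cong:
  assumes "\<And>S. S \<subseteq> A \<Longrightarrow> g S = h S"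
  shows "subset_mean p A g = subset_mean p A h"
  unfolding subset_mean_def using assms by (intro sum.cong) auto

lemma subset_mean_empty [simp]: "subset_mean p {} g = g {}"
  by (simp add: subset_mean_def)

text \<open>Conditioning on whether \<open>a\<close> is chosen: the subsets of
  \<open>insert a A\<close> are the sets \<open>S\<close> and \<open>insert a S\<close> with
  \<open>S \<subseteq> A\<close>, and the weight of \<open>a\<close> splits off as
  \<open>1 - p a\<close> or \<open>p a\<close>.\<close>

lemma subset_mean_insert:
  assumes "finite A" "a \<notin> A"
  shows "subset_mean p (insert a A) g =
    (1 - p a) * subset_mean p A g + p a * subset_mean p A (\<lambda>S. g (insert a S))"
proof -
  let ?w = "\<lambda>B S. (\<Prod>f\<in>S. p f) * (\<Prod>f\<in>B - S. 1 - p f)"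
  have inj: "inj_on (insert a) (Pow A)"
    using assms by (intro inj_onI) (metis PowD insert_ident subsetD)
  have disj: "Pow A \<inter> insert a ` Pow A = {}"
    using assms by auto
  have w0: "?w (insert a A) S = (1 - p a) * ?w A S" if "S \<subseteq> A" for S
  proof -
    have "insert a A - S = insert a (A - S)" using assms that by auto
    then show ?thesis using assms by simp
  qed
  have w1: "?w (insert a A) (insert a S) = p a * ?w A S" if "S \<subseteq> A" for S
  proof -
    have "insert a A - insert a S = A - S" "a \<notin> S" "finite S"
      using assms that finite_subset by auto
    then show ?thesis by simp
  qed
  have "subset_mean p (insert a A) g =
      (\<Sum>S\<in>Pow A. ?w (insert a A) S * g S) +
      (\<Sum>S\<in>insert a ` Pow A. ?w (insert a A) S * g S)"
    unfolding subset_mean_def Pow_insert using assms disj by (intro sum.union_disjoint) auto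
  also have "(\<Sum>S\<in>insert a ` Pow A. ?w (insert a A) S * g S) =
      (\<Sum>S\<in>Pow A. ?w (insert a A) (insert a S) * g (insert a S))"
    using inj by (simp add: sum.reindex)
  also have "\<dots> = (\<Sum>S\<in>Pow A. p a * (?w A S * g (insert a S)))"
    by (intro sum.cong refl) (simp only: w1 Pow_iff mult.assoc)
  also have "(\<Sum>S\<in>Pow A. ?w (insert a A) S * g S) = (\<Sum>S\<in>Pow A. (1 - p a) * (?w A S * g S))"
    by (intro sum.cong refl) (simp only: w0 Pow_iff mult.assoc)
  finally show ?thesis
    by (simp add: subset_mean_def sum_distrib_left)
qed

lemma subset_mean_cmult: "subset_mean p A (\<lambda>S. c * g S) = c * subset_mean p A g"
  by (simp add: subset_mean_def sum_distrib_left mult_ac)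

lemma subset_mean_diff:
  "subset_mean p A (\<lambda>S. g S - h S) = subset_mean p A g - subset_mean p A h"
  by (simp add: subset_mean_def sum_subtractf right_diff_distrib)

lemma subset_mean_sum:
  "subset_mean p A (\<lambda>S. \<Sum>i\<in>I. g i S) = (\<Sum>i\<in>I. subset_mean p A (g i))"
  unfolding subset_mean_def sum_distrib_left by (rule sum.swap)

lemma subset_mean_mono:
  assumes "\<And>f. f \<in> A \<Longrightarrow> 0 \<le> p f \<and> p f \<le> 1" "\<And>S. S \<subseteq> A \<Longrightarrow> g S \<le> h S"
  shows "subset_mean p A g \<le> subset_mean p A h"
  unfolding subset_mean_def
proof (intro sum_mono mult_left_mono mult_nonneg_nonneg prod_nonneg)
  fix S assume "S \<in> Pow A"
  then show "g S \<le> h S" using assms by auto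
qed (use assms in force)+

lemma subset_mean_nonneg:
  assumes "\<And>f. f \<in> A \<Longrightarrow> 0 \<le> p f \<and> p f \<le> 1" "\<And>S. S \<subseteq> A \<Longrightarrow> 0 \<le> g S"
  shows "0 \<le> subset_mean p A g"
  using subset_mean_mono[of A p "\<lambda>_. 0" g] assms by (simp add: subset_mean_def)

text \<open>Expanding the product over \<open>A\<close> means picking one summand from each factor,
  that is, picking the set \<open>S\<close> of those \<open>f\<close> where \<open>p f * c f\<close>
  is taken. This is independence in the form of factorization.\<close>

lemma subset_mean_prod:
  assumes "finite A"
  shows "subset_mean p A (\<lambda>S. \<Prod>f\<in>S. c f) = (\<Prod>f\<in>A. 1 - p f + p f * c f)"
proof -
  have "(\<Prod>f\<in>A. 1 - p f + p f * c f) = (\<Prod>f\<in>A. p f * c f + (1 - p f))"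
    by (simp add: add.commute)
  also have "\<dots> = subset_mean p A (\<lambda>S. \<Prod>f\<in>S. c f)"
    unfolding prod_add[OF assms] subset_mean_def by (intro sum.cong refl) (simp add: prod.distrib)
  finally show ?thesis ..
qed

lemma subset_mean_const:
  assumes "finite A"
  shows "subset_mean p A (\<lambda>_. c) = c"
  using subset_mean_prod[OF assms, of p "\<lambda>_. 1"] subset_mean_cmult[of p A c "\<lambda>_. 1"] by simp

text \<open>Jensen's inequality for the square, by expanding the mean of the squared deviation from
  \<open>?m\<close>.\<close>

lemma subset_mean_variance_nonneg:
  assumes "finite A" "\<And>f. f \<in> A \<Longrightarrow> 0 \<le> p f \<and> p f \<le> 1"
  shows "(subset_mean p A g)\<^sup>2 \<le> subset_mean p A (\<lambda>S. (g S)\<^sup>2)"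
proof -
  let ?m = "subset_mean p A g"
  have "0 \<le> subset_mean p A (\<lambda>S. (g S - ?m)\<^sup>2)"
    using assms by (intro subset_mean_nonneg) auto
  also have "(\<lambda>S. (g S - ?m)\<^sup>2) = (\<lambda>S. (g S)\<^sup>2 - (2 * ?m * g S - ?m\<^sup>2))"
    by (auto simp: power2_eq_square algebra_simps)
  finally show ?thesis
    by (simp only: subset_mean_diff subset_mean_cmult subset_mean_const[OF assms(1)])
      (simp add: power2_eq_square)
qed

text \<open>
  Conditioning on the new element splits the variance into the two conditional variances and the
  variance of the conditional mean; the latter is handled by Jensen's inequality.
\<close>

lemma subset_mean_efron_stein:
  assumes "finite A" "\<And>f. f \<in> A \<Longrightarrow> 0 \<le> p f \<and> p f \<le> 1"
  shows "subset_mean p A (\<lambda>S. (g S)\<^sup>2) - (subset_mean p A g)\<^sup>2 \<le>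
    (\<Sum>i\<in>A. p i * (1 - p i) * subset_mean p A (\<lambda>S. (g (insert i S) - g (S - {i}))\<^sup>2))"
  using assms
proof (induction A arbitrary: g rule: finite_induct)
  case empty
  then show ?case by simp
next
  case (insert a A)
  let ?E = "subset_mean p A" and ?E' = "subset_mean p (insert a A)"
  \<comment> \<open>\<open>?D g i S\<close> is the same whether or not \<open>i\<close> lies in
    \<open>S\<close>; multiplied by \<open>p i * (1 - p i)\<close> it is the variance of
    \<open>g\<close> when only the membership of \<open>i\<close> is resampled.\<close>
  let ?D = "\<lambda>g i S. (g (insert i S) - g (S - {i}))\<^sup>2 :: real"
  let ?V = "\<lambda>g. ?E (\<lambda>S. (g S)\<^sup>2) - (?E g)\<^sup>2"
  let ?R = "\<lambda>g. \<Sum>i\<in>A. p i * (1 - p i) * ?E (?D g i)"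
  \<comment> \<open>On subsets of \<open>A\<close>, \<open>g\<close> and \<open>h\<close> are the
    function conditioned on \<open>a\<close> being absent and present.\<close>
  define h where "h S = g (insert a S)" for S
  have pa: "0 \<le> p a" "p a \<le> 1" using insert.prems by auto
  have ins: "?E' k = (1 - p a) * ?E k + p a * ?E (\<lambda>S. k (insert a S))" for k
    using insert.hyps by (rule subset_mean_insert)
  have Da: "?E' (?D g a) = ?E (\<lambda>S. (h S - g S)\<^sup>2)"
  proof -
    have [simp]: "S - {a} = S" if "S \<subseteq> A" for S using that insert.hyps by auto
    have "?E (\<lambda>S. ?D g a S) = ?E (\<lambda>S. (h S - g S)\<^sup>2)"
      by (intro subset_mean_cong) (simp add: h_def)
    moreover have "?E (\<lambda>S. ?D g a (insert a S)) = ?E (\<lambda>S. (h S - g S)\<^sup>2)"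
      by (intro subset_mean_cong) (simp add: h_def)
    ultimately show ?thesis unfolding ins by (simp only: left_diff_distrib)
  qed
  have Di: "?E' (?D g i) = (1 - p a) * ?E (?D g i) + p a * ?E (?D h i)" if "i \<in> A" for i
  proof -
    have "insert a S - {i} = insert a (S - {i})" for S
      using that insert.hyps by auto
    then have "(\<lambda>S. ?D g i (insert a S)) = ?D h i"
      by (simp add: h_def insert_commute)
    then show ?thesis by (simp add: ins)
  qed
  \<comment> \<open>The law of total variance. The last term is the variance of a variable equal to
    \<open>?E h\<close> with probability \<open>p a\<close> and to \<open>?E g\<close>
    otherwise.\<close>
  have "?E' (\<lambda>S. (g S)\<^sup>2) - (?E' g)\<^sup>2 =
      (1 - p a) * ?V g + p a * ?V h + p a * (1 - p a) * (?E (\<lambda>S. h S - g S))\<^sup>2"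
    unfolding ins subset_mean_diff h_def[symmetric] by (simp add: power2_eq_square algebra_simps)
  also have "\<dots> \<le> (1 - p a) * ?R g + p a * ?R h + p a * (1 - p a) * ?E (\<lambda>S. (h S - g S)\<^sup>2)"
    using insert.prems insert.hyps pa insert.IH[of g] insert.IH[of h]
    by (intro add_mono mult_left_mono subset_mean_variance_nonneg) auto
  also have "(1 - p a) * ?R g + p a * ?R h = (\<Sum>i\<in>A. p i * (1 - p i) * ?E' (?D g i))"
    unfolding sum_distrib_left sum.distrib[symmetric]
    by (intro sum.cong refl) (simp add: Di, simp add: algebra_simps)
  finally show ?case
    using insert.hyps by (simp add: Da)
qed

text \<open>The hypothesis says that \<open>g\<close> does not depend on the membership of
  \<open>i\<close>, so \<open>g S\<close> is independent of the event \<open>i \<in> S\<close>,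
  which has probability \<open>p i\<close>.\<close>

lemma subset_mean_membership:
  assumes "finite A" "i \<in> A" "\<And>S. S \<subseteq> A \<Longrightarrow> g (insert i S) = g (S - {i})"
  shows "p i * subset_mean p A g = subset_mean p A (\<lambda>S. of_bool (i \<in> S) * g S)"
proof -
  define B where "B = A - {i}"
  have B: "finite B" "i \<notin> B" "A = insert i B" using assms by (auto simp: B_def)
  have "subset_mean p B (\<lambda>S. g (insert i S)) = subset_mean p B g"
  proof (rule subset_mean_cong)
    fix S assume "S \<subseteq> B"
    then have "S \<subseteq> A" "S - {i} = S" using B by auto
    then show "g (insert i S) = g S" using assms(3) by simp
  qed
  moreover have "subset_mean p B (\<lambda>S. of_bool (i \<in> S) * g S) = 0"
    using B subset_mean_cong[of B "\<lambda>S. of_bool (i \<in> S) * g S" "\<lambda>_. 0"]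
    by (auto simp: subset_mean_const)
  ultimately show ?thesis
    unfolding B(3) subset_mean_insert[OF B(1,2)] by (simp add: algebra_simps)
qed

text \<open>The size of \<open>S \<inter> T\<close> is a sum of independent indicators, so its
  moment generating function factorizes; each factor is bounded by
  \<open>1 + x \<le> exp x\<close>.\<close>

lemma subset_mean_exp_card_le:
  assumes "finite A" "T \<subseteq> A" "\<And>f. f \<in> A \<Longrightarrow> 0 \<le> p f \<and> p f \<le> 1"
  shows "subset_mean p A (\<lambda>S. exp (t * real (card (S \<inter> T)))) \<le> exp ((exp t - 1) * (\<Sum>f\<in>T. p f))"
proof -
  define c where "c f = (if f \<in> T then exp t else 1)" for f
  have "subset_mean p A (\<lambda>S. exp (t * real (card (S \<inter> T)))) = subset_mean p A (\<lambda>S. \<Prod>f\<in>S. c f)"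
  proof (rule subset_mean_cong)
    fix S assume "S \<subseteq> A"
    then have "finite S" using assms finite_subset by blast
    then have "(\<Prod>f\<in>S. c f) = (\<Prod>f\<in>S \<inter> T. exp t)"
      by (simp add: c_def prod.If_cases Int_def)
    then show "exp (t * real (card (S \<inter> T))) = (\<Prod>f\<in>S. c f)"
      by (simp add: exp_of_nat2_mult)
  qed
  also have "\<dots> = (\<Prod>f\<in>A. 1 + p f * (c f - 1))"
    by (simp add: subset_mean_prod[OF assms(1)] algebra_simps)
  also have "\<dots> \<le> (\<Prod>f\<in>A. exp (p f * (c f - 1)))"
  proof (intro prod_mono conjI)
    fix f assume f: "f \<in> A"
    have "0 \<le> (1 - p f) + p f * c f"
      using assms(3)[OF f] by (intro add_nonneg_nonneg mult_nonneg_nonneg) (auto simp: c_def)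
    then show "0 \<le> 1 + p f * (c f - 1)" by (simp add: algebra_simps)
  qed simp
  also have "\<dots> = exp (\<Sum>f\<in>A. p f * (c f - 1))"
    using assms(1) by (simp add: exp_sum)
  also have "(\<Sum>f\<in>A. p f * (c f - 1)) = (\<Sum>f\<in>T. p f * (c f - 1))"
    using assms by (intro sum.mono_neutral_right) (auto simp: c_def)
  also have "\<dots> = (exp t - 1) * (\<Sum>f\<in>T. p f)"
    by (simp add: c_def sum_distrib_left sum_distrib_right mult.commute)
  finally show ?thesis .
qed

text \<open>Chernoff's method: on the event \<open>P\<close> the exponential of
  \<open>t * card (S \<inter> T) - s\<close> is at least one. A positive \<open>t\<close> serves the
  upper tail, a negative \<open>t\<close> the lower tail.\<close>

lemma subset_mean_markov_exp:
  assumes "finite A" "T \<subseteq> A" "\<And>f. f \<in> A \<Longrightarrow> 0 \<le> p f \<and> p f \<le> 1"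
    and "\<And>S. S \<subseteq> A \<Longrightarrow> P S \<Longrightarrow> s \<le> t * real (card (S \<inter> T))"
  shows "subset_mean p A (\<lambda>S. of_bool (P S)) \<le> exp ((exp t - 1) * (\<Sum>f\<in>T. p f) - s)"
proof -
  have "subset_mean p A (\<lambda>S. of_bool (P S)) \<le>
      subset_mean p A (\<lambda>S. exp (- s) * exp (t * real (card (S \<inter> T))))"
  proof (rule subset_mean_mono[OF assms(3)])
    fix S assume "S \<subseteq> A"
    then show "of_bool (P S) \<le> exp (- s) * exp (t * real (card (S \<inter> T)))"
      using assms(4)[of S] by (simp add: exp_add[symmetric])
  qed
  also have "\<dots> \<le> exp (- s) * exp ((exp t - 1) * (\<Sum>f\<in>T. p f))"
    unfolding subset_mean_cmult using subset_mean_exp_card_le[OF assms(1-3)] by simp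
  finally show ?thesis by (simp add: exp_diff exp_minus divide_inverse mult.commute)
qed

section \<open>Maximum planar matchings\<close>

text \<open>Replaces the indexing by pairwise comparability: the edges form a chain that is strict
  in both coordinates. In this form closure under subsets and planarity of diagonals are immediate.
  Conversely, such a chain is indexed by sorting its top vertices.\<close>

lemma is_planar_matching_iff:
  "is_planar_matching A \<longleftrightarrow> finite A \<and>
    (\<forall>e\<in>A. \<forall>f\<in>A. e \<noteq> f \<longrightarrow> fst e < fst f \<and> snd e < snd f \<or> fst f < fst e \<and> snd f < snd e)"
    (is "_ \<longleftrightarrow> _ \<and> ?C")
proof
  assume A: "is_planar_matching A"
  then obtain i j where ij: "strict_mono_on {1..card A} i" "strict_mono_on {1..card A} j"
    "A = (\<lambda>k. (i k, j k)) ` {1..card A}"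
    unfolding is_planar_matching_def by blast
  have ?C
  proof (intro ballI impI)
    fix e f assume "e \<in> A" "f \<in> A" and ne: "e \<noteq> f"
    then obtain k l where kl: "k \<in> {1..card A}" "e = (i k, j k)" "l \<in> {1..card A}" "f = (i l, j l)"
      using ij(3) by blast
    then have "k < l \<or> l < k" using ne by (cases k l rule: linorder_cases) auto
    then show "fst e < fst f \<and> snd e < snd f \<or> fst f < fst e \<and> snd f < snd e"
      using kl ij(1,2)[THEN strict_mono_onD] by auto
  qed
  then show "finite A \<and> ?C"
    using A by (simp add: is_planar_matching_def is_matching_def)
next
  assume A: "finite A \<and> ?C"
  then have inj: "inj_on fst A"
    by (intro inj_onI) (metis less_irrefl)
  then have card: "card (fst ` A) = card A" by (rule card_image)
  obtain h where h: "bij_betw h {..<card A} (fst ` A)" "strict_mono_on {..<card A} h"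
    using ex_bij_betw_strict_mono_card[of "fst ` A"] A card by auto
  \<comment> \<open>\<open>e k\<close> is the edge with the \<open>k\<close>-th smallest top vertex.
    The enumeration \<open>h\<close> starts at 0 and the indices of a planar matching at 1, hence
    \<open>k - 1\<close>.\<close>
  define e where "e k = inv_into A fst (h (k - 1))" for k
  have eh: "e k \<in> A" "fst (e k) = h (k - 1)" if "k \<in> {1..card A}" for k
  proof -
    have "h (k - 1) \<in> fst ` A"
      using bij_betwE[OF h(1)] that by auto
    then show "e k \<in> A" "fst (e k) = h (k - 1)"
      unfolding e_def by (rule inv_into_into, rule f_inv_into_f)
  qed
  have mono: "strict_mono_on {1..card A} (\<lambda>k. fst (e k))"
  proof (rule strict_mono_onI)
    fix r s assume "r \<in> {1..card A}" "s \<in> {1..card A}" "r < s"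
    then show "fst (e r) < fst (e s)"
      using eh strict_mono_onD[OF h(2), of "r - 1" "s - 1"] by auto
  qed
  moreover have "strict_mono_on {1..card A} (\<lambda>k. snd (e k))"
  proof (rule strict_mono_onI)
    fix r s assume rs: "r \<in> {1..card A}" "s \<in> {1..card A}" "r < s"
    then have less: "fst (e r) < fst (e s)" by (rule strict_mono_onD[OF mono])
    then have "e r \<noteq> e s" by auto
    then have "fst (e r) < fst (e s) \<and> snd (e r) < snd (e s) \<or> fst (e s) < fst (e r) \<and> snd (e s) < snd (e r)"
      using A eh(1)[OF rs(1)] eh(1)[OF rs(2)] by blast
    then show "snd (e r) < snd (e s)" using less by auto
  qed
  moreover have "A = (\<lambda>k. (fst (e k), snd (e k))) ` {1..card A}"
  proof -
    have "inj_on e {1..card A}"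
      using inj_onD[OF strict_mono_on_imp_inj_on[OF mono]] by (intro inj_onI) simp
    then have "card (e ` {1..card A}) = card A"
      by (simp add: card_image)
    then have "e ` {1..card A} = A"
      using eh(1) by (intro card_subset_eq conjunct1[OF A]) auto
    then show ?thesis by simp
  qed
  moreover have "is_matching A"
    unfolding is_matching_def
  proof (intro conjI ballI impI)
    fix e f assume "e \<in> A" "f \<in> A" "e \<noteq> f"
    then have "fst e < fst f \<and> snd e < snd f \<or> fst f < fst e \<and> snd f < snd e"
      using A by blast
    then show "fst e \<noteq> fst f" "snd e \<noteq> snd f" by auto
  qed (use A in simp)
  ultimately show "is_planar_matching A"
    unfolding is_planar_matching_def
    by (intro conjI exI[of _ "\<lambda>k. fst (e k)"] exI[of _ "\<lambda>k. snd (e k)"])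
qed

lemma is_planar_matching_subset:
  "is_planar_matching A \<Longrightarrow> B \<subseteq> A \<Longrightarrow> is_planar_matching B"
  unfolding is_planar_matching_iff using finite_subset by blast

section \<open>Maximum size: attainment, monotonicity and deletion of an edge\<close>

lemma card_le_max_planar_matching:
  assumes "finite G" "A \<subseteq> G" "is_planar_matching A" "length_constrained L A"
  shows "card A \<le> max_planar_matching L G"
  unfolding max_planar_matching_def
proof (rule Max_ge)
  show "finite {card A |A. A \<subseteq> G \<and> is_planar_matching A \<and> length_constrained L A}"
    by (rule finite_subset[of _ "card ` Pow G"]) (use assms(1) in auto)
qed (use assms in auto)

lemma max_planar_matching_attained:
  assumes "finite G"
  obtains A where "A \<subseteq> G" "is_planar_matching A" "length_constrained L A"
    "card A = max_planar_matching L G"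
proof -
  let ?X = "{card A |A. A \<subseteq> G \<and> is_planar_matching A \<and> length_constrained L A}"
  have "finite ?X"
    by (rule finite_subset[of _ "card ` Pow G"]) (use assms in auto)
  \<comment> \<open>The empty matching makes the set nonempty, so that \<open>Max\<close> is a
    genuine maximum.\<close>
  moreover have "card {} \<in> ?X"
    by (rule CollectI, rule exI[of _ "{}"])
      (simp add: is_planar_matching_iff length_constrained_def)
  ultimately have "Max ?X \<in> ?X" by (intro Max_in) auto
  then obtain A where "Max ?X = card A" "A \<subseteq> G" "is_planar_matching A" "length_constrained L A"
    by auto
  then show ?thesis
    by (intro that[of A]) (simp_all add: max_planar_matching_def)
qed

lemma max_planar_matching_mono:
  assumes "finite G" "H \<subseteq> G"
  shows "max_planar_matching L H \<le> max_planar_matching L G"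
proof -
  obtain A where "A \<subseteq> H" "is_planar_matching A" "length_constrained L A"
    "card A = max_planar_matching L H"
    by (rule max_planar_matching_attained[OF finite_subset[OF assms(2,1)], of L])
  then show ?thesis using card_le_max_planar_matching[of G A L] assms by auto
qed

text \<open>A maximum matching loses at most one edge when \<open>i\<close> is deleted, and what
  remains is still planar and constrained.\<close>

lemma max_planar_matching_remove:
  assumes "finite G"
  shows "max_planar_matching L G \<le> max_planar_matching L (G - {i}) + 1"
proof -
  obtain A where A: "A \<subseteq> G" "is_planar_matching A" "length_constrained L A"
    "card A = max_planar_matching L G"
    by (rule max_planar_matching_attained[OF assms, of L])
  have "card (A - {i}) \<le> max_planar_matching L (G - {i})"
    using A assms
    by (intro card_le_max_planar_matching is_planar_matching_subset[OF A(2)])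
      (auto simp: length_constrained_def)
  then show ?thesis using A(4) diff_card_le_card_Diff[of "{i}" A] by simp
qed

text \<open>Fix one maximum matching \<open>A\<close>. Deleting an edge outside \<open>A\<close>
  leaves \<open>A\<close> available, so only the edges of \<open>A\<close> contribute, each at most
  one. This self-bounding property turns the Efron-Stein sum into the mean.\<close>

lemma sum_max_planar_matching_remove:
  assumes "finite G"
  shows "(\<Sum>i\<in>G. real (max_planar_matching L G) - real (max_planar_matching L (G - {i}))) \<le>
    real (max_planar_matching L G)"
proof -
  obtain A where A: "A \<subseteq> G" "is_planar_matching A" "length_constrained L A"
    "card A = max_planar_matching L G"
    by (rule max_planar_matching_attained[OF assms, of L])
  have "(\<Sum>i\<in>G. real (max_planar_matching L G) - real (max_planar_matching L (G - {i}))) \<le>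
      (\<Sum>i\<in>G. of_bool (i \<in> A))"
  proof (rule sum_mono)
    fix i
    show "real (max_planar_matching L G) - real (max_planar_matching L (G - {i})) \<le> of_bool (i \<in> A)"
    proof (cases "i \<in> A")
      case True
      then show ?thesis using max_planar_matching_remove[OF assms, of L i] by simp
    next
      case False
      then have "card A \<le> max_planar_matching L (G - {i})"
        using A assms by (intro card_le_max_planar_matching) auto
      then show ?thesis using False A(4) by simp
    qed
  qed
  also have "\<dots> = real (card A)"
    using A(1) assms by (simp add: of_bool_def sum.If_cases Int_absorb1)
  finally show ?thesis using A(4) by simp
qed

lemma subset_mean_max_planar_matching_variance:
  fixes L :: real
  defines "m \<equiv> \<lambda>S. real (max_planar_matching L S)"
  assumes "finite A" "\<And>f. f \<in> A \<Longrightarrow> 0 \<le> p f \<and> p f \<le> 1"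
  shows "subset_mean p A (\<lambda>S. (m S)\<^sup>2) - (subset_mean p A m)\<^sup>2 \<le> subset_mean p A m"
proof -
  define D where "D i S = m (insert i S) - m (S - {i})" for i S
  have fin: "finite S" if "S \<subseteq> A" for S using that assms finite_subset by blast
  have D: "0 \<le> D i S" "D i S \<le> 1" if "S \<subseteq> A" for i S
  proof -
    show "0 \<le> D i S"
      using max_planar_matching_mono[of "insert i S" "S - {i}" L] fin[OF that]
      by (auto simp: D_def m_def)
    have "insert i S - {i} = S - {i}" by auto
    then show "D i S \<le> 1"
      using max_planar_matching_remove[of "insert i S" L i] fin[OF that]
      by (simp add: D_def m_def)
  qed
  have "subset_mean p A (\<lambda>S. (m S)\<^sup>2) - (subset_mean p A m)\<^sup>2 \<le>
      (\<Sum>i\<in>A. p i * (1 - p i) * subset_mean p A (\<lambda>S. (D i S)\<^sup>2))"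
    unfolding D_def using assms(2,3) by (rule subset_mean_efron_stein)
  \<comment> \<open>The values of \<open>D\<close> lie between 0 and 1, so its square is at most
    \<open>D\<close> itself; the factor \<open>1 - p i\<close> is bounded by 1.\<close>
  also have "\<dots> \<le> (\<Sum>i\<in>A. p i * subset_mean p A (D i))"
  proof (rule sum_mono)
    fix i assume i: "i \<in> A"
    have "subset_mean p A (\<lambda>S. (D i S)\<^sup>2) \<le> subset_mean p A (D i)"
      using D by (intro subset_mean_mono assms(3)) (simp_all add: power2_eq_square mult_left_le)
    moreover have "0 \<le> subset_mean p A (\<lambda>S. (D i S)\<^sup>2)"
      using assms(3) by (intro subset_mean_nonneg) auto
    moreover have "p i * (1 - p i) \<le> p i * 1"
      using assms(3)[OF i] by (intro mult_left_mono) auto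
    ultimately show "p i * (1 - p i) * subset_mean p A (\<lambda>S. (D i S)\<^sup>2) \<le> p i * subset_mean p A (D i)"
      using assms(3)[OF i] by (intro mult_mono) auto
  qed
  \<comment> \<open>Since \<open>D i\<close> ignores the membership of \<open>i\<close>, the factor
    \<open>p i\<close> becomes the indicator of \<open>i \<in> S\<close>. This restricts the sum to
    edges present in \<open>S\<close>, where \<open>D i S\<close> is the loss from deleting
    \<open>i\<close>.\<close>
  also have "\<dots> = (\<Sum>i\<in>A. subset_mean p A (\<lambda>S. of_bool (i \<in> S) * D i S))"
    using assms(2) by (intro sum.cong refl subset_mean_membership) (auto simp: D_def)
  also have "\<dots> = subset_mean p A (\<lambda>S. \<Sum>i\<in>A. of_bool (i \<in> S) * D i S)"
    by (rule subset_mean_sum[symmetric])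
  also have "\<dots> \<le> subset_mean p A m"
  proof (rule subset_mean_mono[OF assms(3)])
    fix S assume S: "S \<subseteq> A"
    have "(\<Sum>i\<in>A. of_bool (i \<in> S) * D i S) = (\<Sum>i\<in>S. of_bool (i \<in> S) * D i S)"
      using S assms(2) by (intro sum.mono_neutral_right) auto
    also have "\<dots> = (\<Sum>i\<in>S. m S - m (S - {i}))"
      by (intro sum.cong refl) (simp add: D_def insert_absorb)
    also have "\<dots> \<le> m S"
      unfolding m_def using fin[OF S] by (rule sum_max_planar_matching_remove)
    finally show "(\<Sum>i\<in>A. of_bool (i \<in> S) * D i S) \<le> m S" .
  qed
  finally show ?thesis .
qed

section \<open>The band of short edges\<close>

lemma edge_length_le_iff:
  "real (edge_length f) \<le> L \<longleftrightarrow> \<bar>real (fst f) - real (snd f)\<bar> \<le> L"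
  unfolding edge_length_def by simp

lemma finite_knn_edges [simp]: "finite (knn_edges n)"
  by (simp add: knn_edges_def)

lemma finite_short_edges [simp]: "finite (short_edges n L)"
  by (simp add: short_edges_def)

lemma short_edges_Sigma:
  "short_edges n L = (SIGMA i:{1..n}. {j\<in>{1..n}. \<bar>real i - real j\<bar> \<le> L})"
  by (auto simp: short_edges_def knn_edges_def edge_length_le_iff)

text \<open>Each top vertex has at least \<open>L\<close> short edges. The bound
  \<open>L \<le> real n\<close> matters: for \<open>n \<ge> 1\<close> and larger \<open>L\<close>
  even all \<open>n * n\<close> edges are fewer than \<open>n * L\<close>.\<close>

lemma card_short_edges_ge:
  assumes "0 \<le> L" "L \<le> real n"
  shows "real n * L \<le> real (card (short_edges n L))"
proof -
  have row: "L \<le> real (card {j\<in>{1..n}. \<bar>real i - real j\<bar> \<le> L})" if i: "i \<in> {1..n}" for i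
  proof -
    define l where "l = nat \<lfloor>L\<rfloor>"
    have l: "real l \<le> L" "L < real l + 1" using assms by (simp_all add: l_def)
    let ?R = "{j\<in>{1..n}. \<bar>real i - real j\<bar> \<le> L}"
    \<comment> \<open>There is room for \<open>l + 1 > L\<close> neighbours on the right, or on the
      left, or else the row is complete and has \<open>n \<ge> L\<close> entries.\<close>
    consider "i + l \<le> n" | "l < i" | "n < i + l" "i \<le> l" by linarith
    then show ?thesis
    proof cases
      case 1
      then have "card {i..i + l} \<le> card ?R"
        using i l by (intro card_mono) auto
      then show ?thesis using l by simp
    next
      case 2
      then have "card {i - l..i} \<le> card ?R"
        using i l by (intro card_mono) (auto simp: of_nat_diff)
      then show ?thesis using l 2 by simp
    next
      case 3
      then have "card {1..n} \<le> card ?R"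
        using i l by (intro card_mono) auto
      then show ?thesis using assms by simp
    qed
  qed
  have "real n * L = (\<Sum>i\<in>{1..n}. L)" by simp
  also have "\<dots> \<le> (\<Sum>i\<in>{1..n}. real (card {j\<in>{1..n}. \<bar>real i - real j\<bar> \<le> L}))"
    using row by (rule sum_mono)
  finally show ?thesis by (simp add: short_edges_Sigma)
qed

lemma card_short_edges_le:
  assumes "1 \<le> L"
  shows "real (card (short_edges n L)) \<le> 3 * real n * L"
proof -
  have row: "real (card {j\<in>{1..n}. \<bar>real i - real j\<bar> \<le> L}) \<le> 3 * L" for i
  proof -
    define l where "l = \<lfloor>L\<rfloor>"
    have l: "1 \<le> l" "real_of_int l \<le> L" "L < real_of_int l + 1" using assms by (simp_all add: l_def)
    let ?R = "{j\<in>{1..n}. \<bar>real i - real j\<bar> \<le> L}"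
    \<comment> \<open>Integers avoid truncated subtraction at the lower end of the interval. Its
      \<open>2 * l + 1\<close> elements number at most \<open>3 * L\<close> because
      \<open>1 \<le> L\<close>.\<close>
    have "card ?R = card (int ` ?R)" by (simp add: card_image)
    also have "\<dots> \<le> card {int i - l..int i + l}"
    proof (rule card_mono)
      show "int ` ?R \<subseteq> {int i - l..int i + l}"
        unfolding l_def by (auto simp: abs_le_iff) linarith+
    qed simp
    finally have "real (card ?R) \<le> real_of_int (2 * l + 1)" using l(1) by simp
    then show ?thesis using l by simp
  qed
  have "real (card (short_edges n L)) = (\<Sum>i\<in>{1..n}. real (card {j\<in>{1..n}. \<bar>real i - real j\<bar> \<le> L}))"
    by (simp add: short_edges_Sigma)
  also have "\<dots> \<le> (\<Sum>i\<in>{1..n}. 3 * L)"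
    using row by (intro sum_mono)
  finally show ?thesis by (simp add: algebra_simps)
qed

lemma max_planar_matching_le_card:
  assumes "S \<subseteq> knn_edges n"
  shows "max_planar_matching L S \<le> card (S \<inter> short_edges n L)"
proof -
  have fin: "finite S" using assms(1) finite_knn_edges by (rule finite_subset)
  obtain A where A: "A \<subseteq> S" "length_constrained L A" "card A = max_planar_matching L S"
    by (rule max_planar_matching_attained[OF fin, of L])
  have "card A \<le> card (S \<inter> short_edges n L)"
    using A assms fin by (intro card_mono) (auto simp: short_edges_def length_constrained_def)
  then show ?thesis using A by simp
qed

text \<open>Edges with a fixed difference of endpoints form a planar matching, as both endpoints
  increase together. The band consists of \<open>2 * l + 1 \<le> 3 * L\<close> such
  diagonals.\<close>

lemma card_le_max_planar_matching_band:
  assumes "S \<subseteq> knn_edges n" "1 \<le> L"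
  shows "real (card (S \<inter> short_edges n L)) \<le> 3 * L * real (max_planar_matching L S)"
proof -
  define l where "l = \<lfloor>L\<rfloor>"
  have l: "1 \<le> l" "real_of_int l \<le> L" "L < real_of_int l + 1" using assms by (simp_all add: l_def)
  have fin: "finite S" using assms(1) finite_knn_edges by (rule finite_subset)
  let ?d = "\<lambda>c. {f \<in> S \<inter> short_edges n L. int (fst f) - int (snd f) = c}"
  have "S \<inter> short_edges n L \<subseteq> (\<Union>c\<in>{- l..l}. ?d c)"
    unfolding l_def by (auto simp: short_edges_def edge_length_le_iff abs_le_iff) linarith+
  then have "card (S \<inter> short_edges n L) \<le> card (\<Union>c\<in>{- l..l}. ?d c)"
    using fin by (intro card_mono) auto
  also have "\<dots> \<le> (\<Sum>c\<in>{- l..l}. card (?d c))"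
    by (rule card_UN_le) simp
  also have "\<dots> \<le> (\<Sum>c\<in>{- l..l}. max_planar_matching L S)"
  proof (rule sum_mono)
    fix c
    show "card (?d c) \<le> max_planar_matching L S"
      using fin by (intro card_le_max_planar_matching)
        (auto simp: is_planar_matching_iff length_constrained_def short_edges_def)
  qed
  finally have "card (S \<inter> short_edges n L) \<le> nat (2 * l + 1) * max_planar_matching L S"
    by (simp add: algebra_simps)
  then have "real (card (S \<inter> short_edges n L)) \<le> real (nat (2 * l + 1) * max_planar_matching L S)"
    by (rule of_nat_mono)
  also have "\<dots> = real_of_int (2 * l + 1) * real (max_planar_matching L S)"
    using l by simp
  also have "\<dots> \<le> 3 * L * real (max_planar_matching L S)"
    using l by (intro mult_right_mono) auto
  finally show ?thesis .
qed

section \<open>The distribution of the random subgraph\<close>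

lemma random_subgraph_subset: "random_subgraph n Y \<omega> \<subseteq> knn_edges n"
  by (auto simp: random_subgraph_def)

context prob_space
begin

text \<open>The subgraph equals \<open>S\<close> exactly when \<open>Y f = 1\<close> on
  \<open>S\<close> and \<open>Y f \<noteq> 1\<close> on the other edges; independence multiplies the
  probabilities of these conditions.\<close>

lemma random_subgraph_eq_prob:
  assumes indep: "indep_vars (\<lambda>_. borel) Y (knn_edges n)" and "n \<ge> 1"
    and prob: "\<And>f. f \<in> knn_edges n \<Longrightarrow> prob {\<omega> \<in> space M. Y f \<omega> = 1} = p f"
    and S: "S \<subseteq> knn_edges n"
  shows "{\<omega> \<in> space M. random_subgraph n Y \<omega> = S} \<in> events"
    and "prob {\<omega> \<in> space M. random_subgraph n Y \<omega> = S} =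
      (\<Prod>f\<in>S. p f) * (\<Prod>f\<in>knn_edges n - S. 1 - p f)"
proof -
  have meas: "Y f \<in> borel_measurable M" if "f \<in> knn_edges n" for f
    using indep that by (auto simp: indep_vars_def)
  define B where "B f = (if f \<in> S then {1::real} else - {1})" for f
  have B: "B f \<in> sets borel" for f by (simp add: B_def)
  \<comment> \<open>An intersection over no edges would be \<open>UNIV\<close> instead of
    \<open>space M\<close>; here \<open>n \<ge> 1\<close> enters.\<close>
  have ne: "knn_edges n \<noteq> {}" using \<open>n \<ge> 1\<close> by (auto simp: knn_edges_def)
  have eq: "{\<omega> \<in> space M. random_subgraph n Y \<omega> = S} = (\<Inter>f\<in>knn_edges n. Y f -` B f \<inter> space M)"
    using ne S by (auto simp: random_subgraph_def B_def split: if_splits)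
  show "{\<omega> \<in> space M. random_subgraph n Y \<omega> = S} \<in> events"
    unfolding eq using meas B ne by (intro sets.finite_INT) (auto intro: measurable_sets)
  have *: "prob (Y f -` B f \<inter> space M) = (if f \<in> S then p f else 1 - p f)" if f: "f \<in> knn_edges n" for f
  proof -
    have ev: "{\<omega> \<in> space M. Y f \<omega> = 1} \<in> events"
      using meas[OF f] by measurable
    have "Y f -` B f \<inter> space M =
        (if f \<in> S then {\<omega> \<in> space M. Y f \<omega> = 1} else space M - {\<omega> \<in> space M. Y f \<omega> = 1})"
      by (auto simp: B_def)
    then show ?thesis using prob[OF f] prob_compl[OF ev] by simp
  qed
  have "prob {\<omega> \<in> space M. random_subgraph n Y \<omega> = S} = (\<Prod>f\<in>knn_edges n. prob (Y f -` B f \<inter> space M))"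
    unfolding eq using indep ne B by (intro indep_varsD_finite) auto
  also have "\<dots> = (\<Prod>f\<in>knn_edges n. if f \<in> S then p f else 1 - p f)"
    by (intro prod.cong refl *)
  also have "\<dots> = (\<Prod>f\<in>S. p f) * (\<Prod>f\<in>knn_edges n - S. 1 - p f)"
    using S by (simp add: prod.If_cases Int_absorb1 Diff_eq)
  finally show "prob {\<omega> \<in> space M. random_subgraph n Y \<omega> = S} =
      (\<Prod>f\<in>S. p f) * (\<Prod>f\<in>knn_edges n - S. 1 - p f)" .
qed

text \<open>The bridge from the probability space to finite sums: a function of the subgraph takes
  finitely many values, one on each event that the subgraph equals \<open>S\<close>.\<close>

lemma expectation_random_subgraph:
  fixes h :: "(nat \<times> nat) set \<Rightarrow> real"
  assumes "indep_vars (\<lambda>_. borel) Y (knn_edges n)" "n \<ge> 1"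
    and "\<And>f. f \<in> knn_edges n \<Longrightarrow> prob {\<omega> \<in> space M. Y f \<omega> = 1} = p f"
  shows "expectation (\<lambda>\<omega>. h (random_subgraph n Y \<omega>)) = subset_mean p (knn_edges n) h"
proof -
  let ?e = "\<lambda>S. {\<omega> \<in> space M. random_subgraph n Y \<omega> = S}"
  note eq = random_subgraph_eq_prob[OF assms]
  have "expectation (\<lambda>\<omega>. h (random_subgraph n Y \<omega>)) =
      expectation (\<lambda>\<omega>. \<Sum>S\<in>Pow (knn_edges n). indicator (?e S) \<omega> * h S)"
  proof (rule Bochner_Integration.integral_cong[OF refl])
    fix \<omega> assume "\<omega> \<in> space M"
    then have "(\<Sum>S\<in>Pow (knn_edges n). indicator (?e S) \<omega> * h S) =
        (\<Sum>S\<in>Pow (knn_edges n). if S = random_subgraph n Y \<omega> then h S else 0)"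
      by (intro sum.cong refl) (auto simp: indicator_def)
    then show "h (random_subgraph n Y \<omega>) = (\<Sum>S\<in>Pow (knn_edges n). indicator (?e S) \<omega> * h S)"
      using random_subgraph_subset[of n Y \<omega>] by simp
  qed
  also have "\<dots> = (\<Sum>S\<in>Pow (knn_edges n). expectation (\<lambda>\<omega>. indicator (?e S) \<omega> * h S))"
    using eq(1) by (intro Bochner_Integration.integral_sum integrable_mult_left) (auto simp: less_top[symmetric])
  also have "\<dots> = subset_mean p (knn_edges n) h"
    unfolding subset_mean_def using eq by (intro sum.cong refl) auto
  finally show ?thesis .
qed

lemma random_subgraph_event:
  assumes "indep_vars (\<lambda>_. borel) Y (knn_edges n)" "n \<ge> 1"
    and "\<And>f. f \<in> knn_edges n \<Longrightarrow> prob {\<omega> \<in> space M. Y f \<omega> = 1} = p f"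
  shows "{\<omega> \<in> space M. P (random_subgraph n Y \<omega>)} \<in> events"
    and "prob {\<omega> \<in> space M. P (random_subgraph n Y \<omega>)} =
      subset_mean p (knn_edges n) (\<lambda>S. of_bool (P S))"
proof -
  let ?X = "{\<omega> \<in> space M. P (random_subgraph n Y \<omega>)}"
  have "?X = (\<Union>S\<in>{S\<in>Pow (knn_edges n). P S}. {\<omega> \<in> space M. random_subgraph n Y \<omega> = S})"
    using random_subgraph_subset[of n Y] by blast
  also have "\<dots> \<in> events"
    using random_subgraph_eq_prob(1)[OF assms] by (intro sets.finite_UN) auto
  finally show X: "?X \<in> events" .
  have "expectation (\<lambda>\<omega>. of_bool (P (random_subgraph n Y \<omega>)) :: real) = expectation (indicator ?X)"
    by (intro Bochner_Integration.integral_cong refl) (auto simp: indicator_def)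
  then show "prob ?X = subset_mean p (knn_edges n) (\<lambda>S. of_bool (P S))"
    using X expectation_random_subgraph[OF assms, of "\<lambda>S. of_bool (P S)"] by simp
qed

end

section \<open>Variance and concentration\<close>

theorem theorem1:
  fixes M :: "'a measure" and n :: nat and L :: real
    and p :: "nat \<times> nat \<Rightarrow> real" and Y :: "nat \<times> nat \<Rightarrow> 'a \<Rightarrow> real"
  assumes "prob_space M"
    and "n \<ge> 1"
    and "\<And>f. f \<in> knn_edges n \<Longrightarrow> 0 \<le> p f \<and> p f \<le> 1"
    and "prob_space.indep_vars M (\<lambda>_. borel) Y (knn_edges n)"
    and "\<And>f. f \<in> knn_edges n \<Longrightarrow> measure M {\<omega> \<in> space M. Y f \<omega> = 1} = p f"
    and "\<And>f. f \<in> knn_edges n \<Longrightarrow> measure M {\<omega> \<in> space M. Y f \<omega> = 0} = 1 - p f"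
    and "L \<ge> 0"
  shows "prob_space.variance M (U n Y L) \<le> 2 * prob_space.expectation M (U n Y L) \<and>
    (1 \<le> L \<and> L \<le> real n \<longrightarrow>
      measure M {\<omega> \<in> space M. real n * p_av n p L / (28 * L) \<le> U n Y L \<omega> \<and>
                               U n Y L \<omega> \<le> 9 * real n * p_av n p L * L / 2}
        \<ge> 1 - 2 * exp (- (real n * p_av n p L * L / 16)))"
proof (intro conjI impI)
  interpret prob_space M by fact
  let ?E = "subset_mean p (knn_edges n)"
  define m where "m S = real (max_planar_matching L S)" for S
  have U: "U n Y L = (\<lambda>\<omega>. m (random_subgraph n Y \<omega>))"
    by (simp add: U_def m_def fun_eq_iff)
  note mean = expectation_random_subgraph[OF assms(4,2,5)]
  note ev = random_subgraph_event[OF assms(4,2,5)]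
  have "variance (U n Y L) = ?E (\<lambda>S. (m S - ?E m)\<^sup>2)"
    using mean[of m] mean[of "\<lambda>S. (m S - ?E m)\<^sup>2"] by (simp only: U)
  also have "(\<lambda>S. (m S - ?E m)\<^sup>2) = (\<lambda>S. (m S)\<^sup>2 - (2 * ?E m * m S - (?E m)\<^sup>2))"
    by (auto simp: power2_eq_square algebra_simps)
  also have "?E \<dots> = ?E (\<lambda>S. (m S)\<^sup>2) - (?E m)\<^sup>2"
    unfolding subset_mean_diff subset_mean_cmult subset_mean_const[OF finite_knn_edges]
    by (simp add: power2_eq_square)
  also have "\<dots> \<le> ?E m"
    unfolding m_def using assms(3) by (intro subset_mean_max_planar_matching_variance) auto
  also have "\<dots> \<le> 2 * ?E m"
    using subset_mean_nonneg[of "knn_edges n" p m] assms(3) by (auto simp: m_def)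
  finally show "variance (U n Y L) \<le> 2 * expectation (U n Y L)"
    using mean[of m] by (simp only: U)

  \<comment> \<open>Both tails of the maximum size\<close>
  assume L: "1 \<le> L \<and> L \<le> real n"
  define T where "T = short_edges n L"
  define a where "a = real n * p_av n p L"
  \<comment> \<open>\<open>\<mu>\<close> is the expected number of edges of the random graph in the
    band; the counts of short edges place it between \<open>a * L\<close> and
    \<open>3 * a * L\<close>.\<close>
  define \<mu> where "\<mu> = (\<Sum>f\<in>T. p f)"
  have T: "T \<subseteq> knn_edges n" by (auto simp: T_def short_edges_def)
  have "real n * L \<le> real (card T)" "real (card T) \<le> 3 * real n * L"
    using L card_short_edges_ge card_short_edges_le by (auto simp: T_def)
  \<comment> \<open>This makes the band nonempty, so the division in \<open>p_av\<close> is not by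
    zero.\<close>
  moreover have "0 < real n * L" using L assms(2) by simp
  ultimately have pav: "\<mu> = real (card T) * p_av n p L" "0 \<le> p_av n p L"
    using T assms(3) by (auto simp: \<mu>_def p_av_def T_def[symmetric] intro!: divide_nonneg_nonneg sum_nonneg)
  have \<mu>: "a * L \<le> \<mu>" "\<mu> \<le> 3 * a * L"
    using mult_right_mono[OF \<open>real n * L \<le> real (card T)\<close> pav(2)]
      mult_right_mono[OF \<open>real (card T) \<le> 3 * real n * L\<close> pav(2)]
    by (simp_all add: pav(1) a_def algebra_simps)
  have a: "0 \<le> a" using pav(2) by (simp add: a_def)
  then have a: "0 \<le> a" "a \<le> a * L"
    using L mult_left_mono[of 1 L a] by simp_all
  let ?low = "\<lambda>S. m S < a / (28 * L)" and ?high = "\<lambda>S. 9 * a * L / 2 < m S"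
  \<comment> \<open>Lower tail with \<open>t = -1\<close>: a maximum size below
    \<open>a / (28 * L)\<close> leaves at most \<open>3 * a / 28\<close> edges in the band.\<close>
  have "?E (\<lambda>S. of_bool (?low S)) \<le> exp ((exp (- 1) - 1) * \<mu> - (- (3 * a / 28)))"
    unfolding \<mu>_def
  proof (rule subset_mean_markov_exp[OF finite_knn_edges T assms(3)])
    fix S assume S: "S \<subseteq> knn_edges n" and low: "?low S"
    have "real (card (S \<inter> T)) \<le> 3 * L * m S"
      unfolding T_def m_def using S L by (intro card_le_max_planar_matching_band) auto
    also have "\<dots> \<le> 3 * L * (a / (28 * L))"
      using low L by (intro mult_left_mono) auto
    also have "\<dots> = 3 * a / 28" using L by simp
    finally show "- (3 * a / 28) \<le> - 1 * real (card (S \<inter> T))" by simp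
  qed
  \<comment> \<open>The exponent is at most \<open>- \<mu> / 2 + 3 * a / 28\<close>. As
    \<open>a * L \<le> \<mu>\<close> and \<open>a \<le> a * L\<close>, this is at most
    \<open>- 11 / 28 * (a * L)\<close>.\<close>
  also have "\<dots> \<le> exp (- (a * L / 16))"
  proof -
    have "(2::real) \<le> exp 1" using exp_ge_add_one_self[of 1] by simp
    then have "exp (- 1) \<le> (1 / 2 :: real)" by (simp add: exp_minus field_simps)
    then have "(exp (- 1) - 1) * \<mu> \<le> (- (1 / 2)) * \<mu>"
      using \<mu> a by (intro mult_right_mono) auto
    then show ?thesis using \<mu> a by simp
  qed
  finally have low: "prob {\<omega> \<in> space M. ?low (random_subgraph n Y \<omega>)} \<le> exp (- (a * L / 16))"
    using ev(2)[of ?low] by simp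
  \<comment> \<open>Upper tail with \<open>t = 1 / 4\<close>: the band contains at least as many
    edges as the maximum matching.\<close>
  have "?E (\<lambda>S. of_bool (?high S)) \<le> exp ((exp (1 / 4) - 1) * \<mu> - 1 / 4 * (9 * a * L / 2))"
    unfolding \<mu>_def
  proof (rule subset_mean_markov_exp[OF finite_knn_edges T assms(3)])
    fix S assume "S \<subseteq> knn_edges n" "?high S"
    then have "9 * a * L / 2 \<le> real (card (S \<inter> T))"
      using max_planar_matching_le_card[of S n L] by (simp add: m_def T_def)
    then show "1 / 4 * (9 * a * L / 2) \<le> 1 / 4 * real (card (S \<inter> T))" by linarith
  qed
  \<comment> \<open>With \<open>\<mu> \<le> 3 * a * L\<close> the exponent is at most
    \<open>15 / 16 - 9 / 8 = - 3 / 16\<close> times \<open>a * L\<close>. The \<open>5 / 16\<close>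
    below is \<open>x + x * x\<close> at \<open>x = 1 / 4\<close>.\<close>
  also have "\<dots> \<le> exp (- (a * L / 16))"
  proof -
    have "exp (1 / 4) - 1 \<le> (5 / 16 :: real)"
      using exp_bound[of "1 / 4 :: real"] by (simp add: power2_eq_square)
    then have "(exp (1 / 4) - 1) * \<mu> \<le> 5 / 16 * \<mu>"
      using \<mu> a by (intro mult_right_mono) auto
    then show ?thesis using \<mu> a by simp
  qed
  finally have high: "prob {\<omega> \<in> space M. ?high (random_subgraph n Y \<omega>)} \<le> exp (- (a * L / 16))"
    using ev(2)[of ?high] by simp
  let ?good = "\<lambda>S. a / (28 * L) \<le> m S \<and> m S \<le> 9 * a * L / 2"
  \<comment> \<open>Union bound over the two ways to leave the interval.\<close>
  have "space M - {\<omega> \<in> space M. ?good (random_subgraph n Y \<omega>)} =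
      {\<omega> \<in> space M. ?low (random_subgraph n Y \<omega>)} \<union> {\<omega> \<in> space M. ?high (random_subgraph n Y \<omega>)}"
    by auto
  then have "1 - prob {\<omega> \<in> space M. ?good (random_subgraph n Y \<omega>)} \<le>
      prob {\<omega> \<in> space M. ?low (random_subgraph n Y \<omega>)} + prob {\<omega> \<in> space M. ?high (random_subgraph n Y \<omega>)}"
    using prob_compl[OF ev(1)[of ?good]] measure_Un_le[OF ev(1)[of ?low] ev(1)[of ?high]]
    by simp
  also have "\<dots> \<le> 2 * exp (- (a * L / 16))" using low high by simp
  finally show "1 - 2 * exp (- (real n * p_av n p L * L / 16)) \<le>
      prob {\<omega> \<in> space M. real n * p_av n p L / (28 * L) \<le> U n Y L \<omega> \<and>
                          U n Y L \<omega> \<le> 9 * real n * p_av n p L * L / 2}"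
    by (simp add: a_def U mult.assoc)
qed

end
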